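(* Assume that $\mathcal{A}$ has an interior feasible point. Let $x^{(0)}\in\mathcal{A}$ be such that $x^{(0)}(e)>0$ for all $e\in[n]$, and let $(x^{(k)})_{k\ge 0}$ be any sequence generated by the following iteration: for each $k\ge 0$, pick any point $v^{(k+1)}\in T(x^{(k)})$ and set $$x^{(k+1)}=x^{(k)}+a_{k+1}\bigl(v^{(k+1)}-x^{(k)}\bigr),\qquad a_k:=\frac{1}{k+1}.$$ Then $x^{(k)}\to x^{\star}$ as $k\to\infty$, where $x^\star$ is the optimal solution of the system problem $\max_{x\in\mathcal{A}}\sum_{e=1}^n w_e(x(e))$.
   Context: Let $m,n\ge 1$ be integers, $[n]=\{1,\dots,n\}$ (users) and $[m]=\{1,\dots,m\}$ (links). Let $A$ be an $m\times n$ matrix with entries in $\{0,1\}$, where $A_{le}=1$ means that the path of user $e$ uses link $l$; every path uses at least one link (every column of $A$ is nonzero). Let $c=(c(l))_{l\in[m]}\in\mathbb{R}^m$ be the link capacities and $\mathcal{A}=\{x\in\mathbb{R}^n : x\ge 0,\ Ax\le c\}$. "$\mathcal{A}$ has an interior feasible point" means that there is $x$ with $x(e)>0$ for all $e\in[n]$ and $(Ax)_l<c(l)$ for all $l\in[m]$. The utility functions $w_e:[0,\infty)\to\mathbb{R}$, $e\in[n]$, are strictly concave, increasing, continuous, and differentiable on $(0,\infty)$. The point $x^\star$ is the unique maximizer of $W(x)=\sum_{e=1}^n w_e(x(e))$ over $\mathcal{A}$. Put $p_e(r)=r\,w_e'(r)$ for $r>0$ and $p_e(0)=\lim_{r\downarrow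 0} r\,w_e'(r)$. For $x\in\mathcal{A}$ define the set $$T(x)=\arg\max_{y\in\mathcal{A}}\ \sum_{e=1}^n p_e(x(e))\log(y(e)),$$ with the conventions $\log 0=-\infty$ and $0\cdot(-\infty)=0$. $T(x)$ is a set of maximizers, possibly not a singleton. *)

theory Defs
  imports "HOL-Analysis.Analysis"
begin

definition strictly_concave_on :: "'a::real_vector set \<Rightarrow> ('a \<Rightarrow> real) \<Rightarrow> bool" where
  "strictly_concave_on S f \<longleftrightarrow> convex S \<and>
     (\<forall>x\<in>S. \<forall>y\<in>S. x \<noteq> y \<longrightarrow>
        (\<forall>u>0. \<forall>v>0. u + v = 1 \<longrightarrow> u * f x + v * f y < f (u *\<^sub>R x + v *\<^sub>R y)))"

(* The index type 'n is the set of users, 'm the set of links. *)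

definition routing_matrix :: "real^'n^'m \<Rightarrow> bool" where
  "routing_matrix A \<longleftrightarrow> (\<forall>l e. A $ l $ e \<in> {0, 1}) \<and> (\<forall>e. \<exists>l. A $ l $ e \<noteq> 0)"

definition feasible :: "real^'n^'m \<Rightarrow> real^'m \<Rightarrow> (real^'n) set" where
  "feasible A c = {x. (\<forall>e. 0 \<le> x $ e) \<and> (\<forall>l. (A *v x) $ l \<le> c $ l)}"

definition has_interior_feasible_point :: "real^'n^'m \<Rightarrow> real^'m \<Rightarrow> bool" where
  "has_interior_feasible_point A c \<longleftrightarrow> (\<exists>x. (\<forall>e. 0 < x $ e) \<and> (\<forall>l. (A *v x) $ l < c $ l))"

(* Only the values on {0..} matter: a utility is a total function on the reals here,
   unconstrained on the negative ones. *)
definition utility_fun :: "(real \<Rightarrow> real) \<Rightarrow> bool" where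
  "utility_fun f \<longleftrightarrow> strictly_concave_on {0..} f \<and> mono_on {0..} f \<and>
     continuous_on {0..} f \<and> (\<forall>r>0. f differentiable (at r))"

definition total_utility :: "('n::finite \<Rightarrow> real \<Rightarrow> real) \<Rightarrow> real^'n \<Rightarrow> real" where
  "total_utility w x = (\<Sum>e\<in>UNIV. w e (x $ e))"

definition payment :: "(real \<Rightarrow> real) \<Rightarrow> real \<Rightarrow> real" where
  "payment f r = (if r > 0 then r * deriv f r else Lim (at_right 0) (\<lambda>s. s * deriv f s))"

(* Applied to nonnegative reals only. In ereal, 0 * (-\<infinity>) = 0. *)
definition log_ext :: "real \<Rightarrow> ereal" where
  "log_ext y = (if y = 0 then -\<infinity> else ereal (ln y))"

definition weighted_log ::
    "('n::finite \<Rightarrow> real \<Rightarrow> real) \<Rightarrow> real^'n \<Rightarrow> real^'n \<Rightarrow> ereal" where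
  "weighted_log w x y = (\<Sum>e\<in>UNIV. ereal (payment (w e) (x $ e)) * log_ext (y $ e))"

definition response_set ::
    "real^'n^'m \<Rightarrow> real^'m \<Rightarrow> ('n::finite \<Rightarrow> real \<Rightarrow> real) \<Rightarrow> real^'n \<Rightarrow> (real^'n) set" where
  "response_set A c w x = {v. is_arg_max (weighted_log w x) (\<lambda>y. y \<in> feasible A c) v}"

definition step_size :: "nat \<Rightarrow> real" where
  "step_size k = 1 / (real k + 1)"

end

(* Write y for the maximizer. First-order optimality of v in the response set of x says that
   sum_e p_e(x_e) u_e / v_e <= sum_e p_e(x_e) for all feasible u. With u = y and concavity of
   the utilities, the function
     V(x) = sum_e y_e * (integral of w_e'(r) / r dr up to x_e)
   grows along x' = v - x at rate at least W(y) - W(x). Moreover V is concave and its gradient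
   at y is that of W on the support of y, so y maximizes V over the feasible set. To make V
   tractable near the boundary, w_e' is replaced by its minimum with the chord slope
   (w_e(y_e) - w_e(0)) / y_e. The result is bounded and uniformly continuous, and V is concave
   in the variables ln x_e, so a discrete step loses only o(a_k) against the continuous flow.
   As the step sizes are not summable, V(x_k) tends to V(y); this forces convergence on the
   support of y, and strict monotonicity of the utilities settles the other coordinates. *)
theory Submission
  imports Defs
begin

section \<open>Utility functions\<close>

lemma utility_fun_strict_concaveD:
  assumes "utility_fun f" "0 \<le> x" "0 \<le> y" "x \<noteq> y" "0 < u" "0 < v" "u + v = 1"
  shows "u * f x + v * f y < f (u * x + v * y)"
proof -
  have "\<forall>x\<in>{0..}. \<forall>y\<in>{0..}. x \<noteq> y \<longrightarrow>
      (\<forall>u>0. \<forall>v>0. u + v = 1 \<longrightarrow> u * f x + v * f y < f (u *\<^sub>R x + v *\<^sub>R y))"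
    using assms(1) unfolding utility_fun_def strictly_concave_on_def by (elim conjE)
  then show ?thesis using assms by simp
qed

text \<open>\<open>mono_on\<close> is weak monotonicity; a flat stretch would put the midpoint value
  on the chord, against strict concavity.\<close>

lemma utility_fun_strict_mono:
  assumes f: "utility_fun f" and "0 \<le> x" "x < y"
  shows "f x < f y"
proof -
  have le: "f x \<le> f ((x + y) / 2)" "f ((x + y) / 2) \<le> f y"
    using assms by (auto simp: utility_fun_def intro!: mono_onD[of "{0..}" f])
  have "(1/2) * f x + (1/2) * f y < f ((1/2) * x + (1/2) * y)"
    using assms by (intro utility_fun_strict_concaveD) auto
  then show ?thesis using le by (simp add: add_divide_distrib)
qed

lemma utility_fun_has_derivative:
  assumes "utility_fun f" "0 < r"
  shows "(f has_real_derivative deriv f r) (at r)"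
  using assms by (simp add: utility_fun_def DERIV_deriv_iff_real_differentiable)

text \<open>The tangent inequality for the convex function \<open>- f\<close>. The point of tangency
  is interior, but \<open>y\<close> may be the endpoint 0.\<close>

lemma utility_fun_below_tangent:
  assumes f: "utility_fun f" and "0 < x" "0 \<le> y"
  shows "f y - f x \<le> deriv f x * (y - x)"
proof -
  have "convex_on {0..} (\<lambda>r. - f r)"
  proof (rule convex_onI)
    fix t x y :: real
    assume *: "0 < t" "t < 1" "x \<in> {0..}" "y \<in> {0..}"
    have "(1 - t) * f x + t * f y \<le> f ((1 - t) *\<^sub>R x + t *\<^sub>R y)"
    proof (cases "x = y")
      case True
      then show ?thesis by (simp add: algebra_simps)
    next
      case False
      then show ?thesis
        using utility_fun_strict_concaveD[OF f, of x y "1 - t" t] * by simp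
    qed
    then show "- f ((1 - t) *\<^sub>R x + t *\<^sub>R y) \<le> (1 - t) * - f x + t * - f y"
      by simp
  qed simp
  moreover have "((\<lambda>r. - f r) has_real_derivative - deriv f x) (at x within {0..})"
    using utility_fun_has_derivative[OF assms(1,2)]
    by (auto intro!: derivative_eq_intros intro: has_field_derivative_at_within)
  ultimately have "- f y - - f x \<ge> - deriv f x * (y - x)"
    using assms by (intro convex_on_imp_above_tangent[of "{0..}"]) auto
  then show ?thesis by simp
qed

lemma utility_fun_deriv_pos:
  assumes "utility_fun f" "0 < r"
  shows "0 < deriv f r"
  using utility_fun_below_tangent[of f r "r + 1"] utility_fun_strict_mono[of f r "r + 1"] assms
  by simp

lemma utility_fun_deriv_antimono:
  assumes "utility_fun f" "0 < r" "r \<le> s"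
  shows "deriv f s \<le> deriv f r"
proof (cases "r = s")
  case False
  have "deriv f s * (s - r) \<le> f s - f r" "f s - f r \<le> deriv f r * (s - r)"
    using utility_fun_below_tangent[of f r s] utility_fun_below_tangent[of f s r] assms
    by (simp_all add: algebra_simps)
  then have "deriv f s * (s - r) \<le> deriv f r * (s - r)" by simp
  then show ?thesis using False assms by simp
qed simp

text \<open>The tangent at \<open>r\<close>, read off at 0. It keeps payments bounded even if the
  derivative blows up at 0.\<close>

lemma utility_fun_payment_le:
  assumes "utility_fun f" "0 < r"
  shows "r * deriv f r \<le> f r - f 0"
  using utility_fun_below_tangent[of f r 0] assms by (simp add: algebra_simps)

lemma utility_fun_isCont:
  assumes "utility_fun f" "0 < r"
  shows "isCont f r"
  using utility_fun_has_derivative[OF assms] by (rule DERIV_isCont)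

text \<open>By concavity, difference quotients with a fixed increment \<open>h\<close> bound
  \<open>deriv f s\<close> from below if \<open>h > 0\<close> and from above if
  \<open>h < 0\<close>. They are continuous in \<open>s\<close>, and at \<open>r\<close> they are
  close to \<open>deriv f r\<close> for small \<open>h\<close>.\<close>

lemma utility_fun_isCont_deriv:
  assumes f: "utility_fun f" and r: "0 < r"
  shows "isCont (deriv f) r"
  unfolding isCont_def
proof (rule order_tendstoI)
  have quot: "((\<lambda>h. (f (r + h) - f r) / h) \<longlongrightarrow> deriv f r) (at 0)"
    using utility_fun_has_derivative[OF f r] by (simp add: DERIV_def)
  have shift: "((\<lambda>s. (f (s + h) - f s) / h) \<longlongrightarrow> (f (r + h) - f r) / h) (at r)"
    if "h \<noteq> 0" "- r < h" for h
  proof -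
    have "isCont (\<lambda>s. f (s + h)) r"
    proof (rule isCont_o2[where g = f])
      show "isCont f (r + h)" using that by (intro utility_fun_isCont[OF f]) simp
    qed simp
    then show ?thesis using that utility_fun_isCont[OF f r]
      by (intro tendsto_intros) (auto simp: isCont_def)
  qed
  {
    fix u assume u: "u < deriv f r"
    have "eventually (\<lambda>h. u < (f (r + h) - f r) / h) (at_right 0)"
      using order_tendstoD(1)[OF quot u] by (simp add: eventually_at_split)
    then have "eventually (\<lambda>h. u < (f (r + h) - f r) / h \<and> h > 0) (at_right 0)"
      by (rule eventually_conj) (simp add: eventually_at_right_less)
    then obtain h where h: "u < (f (r + h) - f r) / h" "h > 0"
      using eventually_happens trivial_limit_at_right_real by blast
    have "eventually (\<lambda>s. u < (f (s + h) - f s) / h) (at r)"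
      using order_tendstoD(1)[OF shift h(1)] h r by simp
    moreover have "eventually (\<lambda>s. 0 < s) (at r)"
      using r by (intro order_tendstoD(1)[OF tendsto_ident_at]) simp
    ultimately show "eventually (\<lambda>s. u < deriv f s) (at r)"
    proof eventually_elim
      case (elim s)
      then have "(f (s + h) - f s) / h \<le> deriv f s"
        using utility_fun_below_tangent[OF f, of s "s + h"] h by (simp add: field_simps)
      then show ?case using elim by simp
    qed
  next
    fix u assume u: "deriv f r < u"
    have "eventually (\<lambda>h. (f (r + h) - f r) / h < u) (at_left 0)"
      using order_tendstoD(2)[OF quot u] by (simp add: eventually_at_split)
    moreover have "eventually (\<lambda>h. h \<in> {-r<..<0}) (at_left 0)"
      using r by (intro eventually_at_left_real) simp
    ultimately have "eventually (\<lambda>h. (f (r + h) - f r) / h < u \<and> h \<in> {-r<..<0}) (at_left 0)"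
      by (rule eventually_conj)
    then obtain h where h: "(f (r + h) - f r) / h < u" "h < 0" "- r < h"
      using eventually_happens trivial_limit_at_left_real greaterThanLessThan_iff by blast
    have "eventually (\<lambda>s. (f (s + h) - f s) / h < u) (at r)"
      using order_tendstoD(2)[OF shift h(1)] h r by simp
    \<comment> \<open>Since \<open>h < 0\<close>, this keeps both \<open>s\<close> and
      \<open>s + h\<close> positive for the tangent inequality.\<close>
    moreover have "eventually (\<lambda>s. - h < s) (at r)"
      using h by (intro order_tendstoD(1)[OF tendsto_ident_at]) simp
    ultimately show "eventually (\<lambda>s. deriv f s < u) (at r)"
    proof eventually_elim
      case (elim s)
      then have "deriv f s \<le> (f (s + h) - f s) / h"
        using utility_fun_below_tangent[OF f, of s "s + h"] h by (simp add: field_simps)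
      then show ?case using elim by simp
    qed
  }
qed

section \<open>Capped slopes and the logarithmic potential\<close>

text \<open>The cap keeps the slope bounded near \<open>0\<close>, where the derivative of \<open>f\<close> may blow up, while
  the inequality of \<open>capped_slope_gain\<close> below stays valid. For \<open>y = 0\<close> the junk value of the
  division makes the cap \<open>0\<close>.\<close>

definition capped_slope :: "(real \<Rightarrow> real) \<Rightarrow> real \<Rightarrow> real \<Rightarrow> real" where
  "capped_slope f y r = min (deriv f r) ((f y - f 0) / y)"

lemma capped_slope_le_deriv: "capped_slope f y r \<le> deriv f r"
  by (simp add: capped_slope_def)

lemma capped_slope_pos:
  assumes "utility_fun f" "0 < y" "0 < r"
  shows "0 < capped_slope f y r"
  using utility_fun_strict_mono[of f 0 y] utility_fun_deriv_pos[of f r] assms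
  by (simp add: capped_slope_def)

lemma capped_slope_nonneg:
  assumes "utility_fun f" "0 \<le> y" "0 < r"
  shows "0 \<le> capped_slope f y r"
  using capped_slope_pos[of f y r] utility_fun_deriv_pos[of f r] assms
  by (cases "y = 0") (simp_all add: capped_slope_def)

lemma capped_slope_antimono:
  assumes "utility_fun f" "0 < r" "r \<le> s"
  shows "capped_slope f y s \<le> capped_slope f y r"
  unfolding capped_slope_def using utility_fun_deriv_antimono[OF assms] by (intro min.mono) auto

text \<open>The chord from 0 to \<open>y\<close> is at least as steep as the tangent at
  \<open>y\<close>, so the cap is inactive there and first-order information at the optimum survives
  on its support.\<close>

lemma capped_slope_at:
  assumes "utility_fun f" "0 < y"
  shows "capped_slope f y y = deriv f y"
  using utility_fun_payment_le[OF assms] assms by (simp add: capped_slope_def field_simps)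

lemma capped_slope_isCont:
  assumes "utility_fun f" "0 < r"
  shows "isCont (capped_slope f y) r"
  unfolding capped_slope_def
  using utility_fun_isCont_deriv[OF assms] by (intro continuous_intros)

text \<open>With an inactive cap or \<open>y = 0\<close> this is the tangent inequality. With an
  active cap, \<open>y * capped_slope f y x\<close> equals \<open>f y - f 0\<close>, and the payment
  bound controls \<open>x * deriv f x\<close>. Through this estimate the utility gap enters the
  growth of the potential.\<close>

lemma capped_slope_gain:
  assumes f: "utility_fun f" and x: "0 < x" and y: "0 \<le> y"
  shows "f y - f x \<le> y * capped_slope f y x - x * deriv f x"
proof (cases "y = 0 \<or> deriv f x \<le> (f y - f 0) / y")
  case True
  then show ?thesis
    using utility_fun_below_tangent[OF f x y] y x by (auto simp: capped_slope_def algebra_simps)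
next
  case False
  then have "y * capped_slope f y x = f y - f 0" by (simp add: capped_slope_def min_def)
  then show ?thesis using utility_fun_payment_le[OF f x] by simp
qed

text \<open>An antitone bounded slope has its supremum as limit at 0, so it extends continuously to
  the compact interval \<open>{0..M}\<close> and is uniformly continuous there. The sequences
  themselves may approach 0.\<close>

lemma capped_slope_diff_tendsto_0:
  assumes f: "utility_fun f"
    and s: "\<And>k. s k \<in> {0<..M}" and t: "\<And>k. t k \<in> {0<..M}"
    and st: "(\<lambda>k. s k - t k) \<longlonglongrightarrow> 0"
  shows "(\<lambda>k. capped_slope f y (s k) - capped_slope f y (t k)) \<longlonglongrightarrow> 0"
proof -
  define L where "L = (SUP r\<in>{0<..}. capped_slope f y r)"
  define g where "g = (\<lambda>r. if r = 0 then L else capped_slope f y r)"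
  have bdd: "bdd_above (capped_slope f y ` {0<..})"
    by (rule bdd_aboveI[of _ "(f y - f 0) / y"]) (auto simp: capped_slope_def)
  have "(capped_slope f y \<longlongrightarrow> L) (at_right 0)"
  proof (rule order_tendstoI)
    fix u assume "u < L"
    then obtain r where r: "r > 0" "u < capped_slope f y r"
      unfolding L_def using less_cSUP_iff[OF _ bdd] by auto
    have "eventually (\<lambda>s. s \<in> {0<..<r}) (at_right 0)"
      using r by (intro eventually_at_right_real)
    then show "eventually (\<lambda>s. u < capped_slope f y s) (at_right 0)"
    proof eventually_elim
      case (elim s)
      then show ?case using capped_slope_antimono[OF f, of s r y] r by auto
    qed
  next
    fix u assume "L < u"
    have "eventually (\<lambda>s. s \<in> {0<..<1}) (at_right (0::real))"
      by (intro eventually_at_right_real) simp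
    then show "eventually (\<lambda>s. capped_slope f y s < u) (at_right 0)"
    proof eventually_elim
      case (elim s)
      then have "capped_slope f y s \<le> L" unfolding L_def by (intro cSUP_upper bdd) auto
      then show ?case using \<open>L < u\<close> by simp
    qed
  qed
  moreover have "eventually (\<lambda>r. capped_slope f y r = g r) (at_right 0)"
    by (rule eventually_mono[OF eventually_at_right_less]) (simp add: g_def)
  ultimately have lim: "(g \<longlongrightarrow> g 0) (at_right 0)"
    using Lim_transform_eventually by (simp add: g_def)
  have "continuous_on {0..M} g"
    unfolding continuous_on_eq_continuous_within
  proof
    fix r assume r: "r \<in> {0..M}"
    show "continuous (at r within {0..M}) g"
    proof (cases "r = 0")
      case True
      \<comment> \<open>The fact \<open>s 0\<close> supplies \<open>0 < M\<close>.\<close>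
      have "(g \<longlongrightarrow> g 0) (at 0 within {0..M})"
        using lim s[of 0] by (simp add: at_within_Icc_at_right)
      then show ?thesis using True by (simp add: continuous_within)
    next
      case False
      then have "isCont g r \<longleftrightarrow> isCont (capped_slope f y) r"
        by (intro isCont_cong eventually_mono[OF t1_space_nhds[of r 0]]) (simp_all add: g_def)
      then show ?thesis
        using capped_slope_isCont[OF f, of r y] False r by (auto intro: continuous_at_imp_continuous_at_within)
    qed
  qed
  then have "uniformly_continuous_on {0..M} g"
    by (intro compact_uniformly_continuous) auto
  then have "(\<lambda>k. dist (g (s k)) (g (t k))) \<longlonglongrightarrow> 0"
    using s t st unfolding uniformly_continuous_on_sequentially
    by (auto simp: dist_real_def greaterThanAtMost_iff less_imp_le tendsto_rabs_zero_iff)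
  moreover have "g (s k) = capped_slope f y (s k)" "g (t k) = capped_slope f y (t k)" for k
    using s[of k] t[of k] by (auto simp: g_def)
  ultimately show ?thesis by (simp add: dist_real_def tendsto_rabs_zero_iff)
qed

lemma capped_slope_antiderivative:
  assumes "utility_fun f"
  shows "\<exists>H. \<forall>t. (H has_real_derivative capped_slope f y (exp t)) (at t)"
proof -
  have "isCont (\<lambda>t. capped_slope f y (exp t)) t" for t
    by (rule isCont_o2[OF isCont_exp]) (simp add: capped_slope_isCont[OF assms])
  then show ?thesis
    using einterval_antiderivative[of "-\<infinity>" "\<infinity>" "\<lambda>t. capped_slope f y (exp t)"]
    by (auto simp: has_real_derivative_iff_has_vector_derivative)
qed

text \<open>At \<open>ln x\<close> this is the integral up to \<open>x\<close> of the capped slope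
  divided by \<open>r\<close>, after substituting \<open>r = exp t\<close>. The choice leaves an
  additive constant open; the argument uses differences.\<close>

definition log_potential :: "(real \<Rightarrow> real) \<Rightarrow> real \<Rightarrow> real \<Rightarrow> real" where
  "log_potential f y = (SOME H. \<forall>t. (H has_real_derivative capped_slope f y (exp t)) (at t))"

lemma log_potential_has_derivative:
  assumes "utility_fun f"
  shows "(log_potential f y has_real_derivative capped_slope f y (exp t)) (at t)"
  using someI_ex[OF capped_slope_antiderivative[OF assms]] unfolding log_potential_def by blast

text \<open>The derivative in \<open>t\<close> is antitone, so the potential is concave and lies
  below its tangent at \<open>ln z\<close>. Taking the slope at the endpoint \<open>z\<close> gives
  a lower bound without remainder term.\<close>

lemma log_potential_diff_ge:
  assumes f: "utility_fun f" and "0 < x" "0 < z"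
  shows "log_potential f y (ln z) - log_potential f y (ln x) \<ge> capped_slope f y z * (ln z - ln x)"
proof -
  have "convex_on UNIV (\<lambda>t. - log_potential f y t)"
  proof (rule convex_on_realI)
    show "((\<lambda>t. - log_potential f y t) has_real_derivative - capped_slope f y (exp t)) (at t)" for t
      by (intro derivative_intros log_potential_has_derivative f)
  qed (use capped_slope_antimono[OF f] in auto)
  moreover have "((\<lambda>t. - log_potential f y t) has_real_derivative - capped_slope f y (exp (ln z))) (at (ln z))"
    by (intro derivative_intros log_potential_has_derivative f)
  ultimately have "- log_potential f y (ln x) - - log_potential f y (ln z)
      \<ge> - capped_slope f y (exp (ln z)) * (ln x - ln z)"
    by (intro convex_on_imp_above_tangent[of UNIV]) auto
  then show ?thesis using assms by (simp add: algebra_simps)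
qed

section \<open>The feasible set\<close>

text \<open>The path of \<open>e\<close> uses some link, whose capacity bounds the coordinate
  because all terms of that constraint are nonnegative. Summing over the links makes the bound
  independent of \<open>e\<close>.\<close>

lemma feasible_le_capacity_sum:
  assumes "routing_matrix A" "x \<in> feasible A c"
  shows "x $ e \<le> (\<Sum>l\<in>UNIV. \<bar>c $ l\<bar>)"
proof -
  obtain l where l: "A $ l $ e = 1"
    using assms(1) unfolding routing_matrix_def by fast
  have A: "0 \<le> A $ l $ f" for f
    using assms(1) unfolding routing_matrix_def by (metis insertE singletonD order_refl zero_le_one)
  have "x $ e = A $ l $ e * x $ e" using l by simp
  also have "\<dots> \<le> (\<Sum>f\<in>UNIV. A $ l $ f * x $ f)"
    using assms(2) A by (intro member_le_sum) (auto simp: feasible_def)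
  also have "\<dots> \<le> c $ l"
    using assms(2) by (auto simp: feasible_def matrix_vector_mult_def)
  also have "\<dots> \<le> \<bar>c $ l\<bar>" by simp
  also have "\<dots> \<le> (\<Sum>l\<in>UNIV. \<bar>c $ l\<bar>)" by (intro member_le_sum) auto
  finally show ?thesis .
qed

lemma feasible_downward_closed:
  assumes "routing_matrix A" "x \<in> feasible A c" "\<And>e. 0 \<le> z $ e" "\<And>e. z $ e \<le> x $ e"
  shows "z \<in> feasible A c"
proof -
  have A: "0 \<le> A $ l $ f" for l f
    using assms(1) unfolding routing_matrix_def by (metis insertE singletonD order_refl zero_le_one)
  have "(A *v z) $ l \<le> (A *v x) $ l" for l
    using assms A by (auto simp: matrix_vector_mult_def intro!: sum_mono mult_left_mono)
  then show ?thesis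
    using assms unfolding feasible_def by simp (meson order_trans)
qed

lemma convex_feasible: "convex (feasible (A :: real^'n^'m) c)"
proof (rule convexI)
  fix x y :: "real^'n" and u v :: real
  assume *: "x \<in> feasible A c" "y \<in> feasible A c" "0 \<le> u" "0 \<le> v" "u + v = 1"
  have "u * (A *v x) $ l + v * (A *v y) $ l \<le> c $ l" for l
    using * by (intro convex_bound_le) (auto simp: feasible_def)
  then show "u *\<^sub>R x + v *\<^sub>R y \<in> feasible A c"
    using * by (auto simp: feasible_def matrix_vector_right_distrib matrix_vector_mult_scaleR)
qed

lemma feasible_segment:
  assumes "x \<in> feasible A c" "y \<in> feasible A c" "0 \<le> t" "t \<le> 1"
  shows "x + t *\<^sub>R (y - x) \<in> feasible A c"
proof -
  have "(1 - t) *\<^sub>R x + t *\<^sub>R y \<in> feasible A c"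
    using assms by (intro convexD[OF convex_feasible]) auto
  then show ?thesis by (simp add: algebra_simps)
qed

lemma compact_feasible:
  assumes "routing_matrix A"
  shows "compact (feasible A c)"
proof -
  have "closed (feasible A c)"
    unfolding feasible_def
    by (intro closed_Collect_conj closed_Collect_all closed_Collect_le continuous_intros
        continuous_on_component matrix_vector_mult_linear_continuous_on)
  moreover have "feasible A c \<subseteq> cbox 0 (\<chi> e. \<Sum>l\<in>UNIV. \<bar>c $ l\<bar>)"
    using feasible_le_capacity_sum[OF assms]
    by (auto simp: mem_box_cart) (auto simp: feasible_def)
  ultimately show ?thesis
    using bounded_cbox bounded_subset compact_eq_bounded_closed by blast
qed

lemma continuous_on_total_utility:
  assumes "\<And>e. utility_fun (w e)"
  shows "continuous_on (feasible A c) (total_utility w)"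
  unfolding total_utility_def
proof (intro continuous_on_sum)
  fix e
  have "continuous_on {0..} (w e)" using assms[of e] by (simp add: utility_fun_def)
  then show "continuous_on (feasible A c) (\<lambda>x. w e (x $ e))"
    by (rule continuous_on_compose2) (auto intro!: continuous_intros simp: feasible_def)
qed

section \<open>Optimality conditions\<close>

lemma has_real_derivative_nonpos_if_right_max:
  assumes "(\<phi> has_real_derivative D) (at 0)" "\<And>t. 0 < t \<Longrightarrow> t < 1 \<Longrightarrow> \<phi> t \<le> \<phi> 0"
  shows "D \<le> (0::real)"
proof (rule ccontr)
  assume "\<not> D \<le> 0"
  then obtain d where d: "d > 0" "\<forall>h>0. h < d \<longrightarrow> \<phi> 0 < \<phi> (0 + h)"
    using DERIV_pos_inc_right[OF assms(1)] by auto
  have "\<phi> 0 < \<phi> (min d 1 / 2)" using d by (auto simp: min_def)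
  moreover have "\<phi> (min d 1 / 2) \<le> \<phi> 0" using d by (intro assms(2)) (auto simp: min_def)
  ultimately show False by simp
qed

text \<open>The derivative of total utility along a feasible segment leaving the maximizer is
  nonpositive. The outer factor \<open>y $ e\<close> cancels the junk quotient at
  \<open>y $ e = 0\<close>, and the ratio form suits the logarithmic comparison later.\<close>

lemma optimum_first_order:
  fixes A :: "real^'n^'m"
  assumes A: "routing_matrix A" and w: "\<And>e. utility_fun (w e)"
    and opt: "is_arg_max (total_utility w) (\<lambda>x. x \<in> feasible A c) y"
    and x: "x \<in> feasible A c"
  shows "(\<Sum>e\<in>UNIV. y $ e * (deriv (w e) (y $ e) * (x $ e / y $ e - 1))) \<le> 0"
proof -
  have y: "y \<in> feasible A c" and max: "\<And>u. u \<in> feasible A c \<Longrightarrow> total_utility w u \<le> total_utility w y"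
    using opt by (auto simp: is_arg_max_def not_less)
  \<comment> \<open>Coordinates with \<open>y $ e = 0\<close> are frozen, since the utility need not be differentiable at \<open>0\<close>.\<close>
  define z :: "real^'n" where "z = (\<chi> e. if y $ e = 0 then 0 else x $ e)"
  have z: "z \<in> feasible A c"
    using x by (intro feasible_downward_closed[OF A x]) (auto simp: z_def feasible_def)
  define \<phi> where "\<phi> = (\<lambda>t. \<Sum>e\<in>UNIV. w e (y $ e + t * (z $ e - y $ e)))"
  have "\<phi> t \<le> \<phi> 0" if "0 < t" "t < 1" for t
    using max[OF feasible_segment[OF y z, of t]] that by (simp add: \<phi>_def total_utility_def)
  moreover have "(\<phi> has_real_derivative
      (\<Sum>e\<in>UNIV. y $ e * (deriv (w e) (y $ e) * (x $ e / y $ e - 1)))) (at 0)"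
    unfolding \<phi>_def
  proof (rule DERIV_sum)
    fix e
    show "((\<lambda>t. w e (y $ e + t * (z $ e - y $ e))) has_real_derivative
        y $ e * (deriv (w e) (y $ e) * (x $ e / y $ e - 1))) (at 0)"
    proof (cases "y $ e = 0")
      case False
      then have "0 < y $ e" using y by (auto simp: feasible_def less_le)
      then have "(w e has_real_derivative deriv (w e) (y $ e)) (at (y $ e + 0 * (z $ e - y $ e)))"
        using utility_fun_has_derivative[OF w] by simp
      then have "((\<lambda>t. w e (y $ e + t * (z $ e - y $ e))) has_real_derivative
          deriv (w e) (y $ e) * (z $ e - y $ e)) (at 0)"
        by (rule DERIV_chain2) (auto intro!: derivative_eq_intros)
      then show ?thesis using False by (simp add: z_def right_diff_distrib mult_ac)
    qed (simp add: z_def)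
  qed
  ultimately show ?thesis by (intro has_real_derivative_nonpos_if_right_max)
qed

text \<open>Strict concavity in a differing coordinate would lift the feasible midpoint above the
  maximum if \<open>x\<close> were optimal too.\<close>

lemma optimum_unique:
  assumes w: "\<And>e. utility_fun (w e)"
    and opt: "is_arg_max (total_utility w) (\<lambda>x. x \<in> feasible A c) y"
    and x: "x \<in> feasible A c" "x \<noteq> y"
  shows "total_utility w x < total_utility w y"
proof -
  have y: "y \<in> feasible A c" and max: "\<And>u. u \<in> feasible A c \<Longrightarrow> total_utility w u \<le> total_utility w y"
    using opt by (auto simp: is_arg_max_def not_less)
  obtain f where f: "x $ f \<noteq> y $ f" using x(2) by (auto simp: vec_eq_iff)
  define z where "z = x + (1/2) *\<^sub>R (y - x)"
  have z: "z $ e = (1/2) * x $ e + (1/2) * y $ e" for e by (simp add: z_def field_simps)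
  have lt: "(1/2) * w e (x $ e) + (1/2) * w e (y $ e) < w e (z $ e)" if "x $ e \<noteq> y $ e" for e
    unfolding z using x y that by (intro utility_fun_strict_concaveD[OF w]) (auto simp: feasible_def)
  have le: "(1/2) * w e (x $ e) + (1/2) * w e (y $ e) \<le> w e (z $ e)" for e
    using lt[of e] by (cases "x $ e = y $ e") (auto simp: z)
  have "(\<Sum>e\<in>UNIV. (1/2) * w e (x $ e) + (1/2) * w e (y $ e)) < total_utility w z"
    unfolding total_utility_def using le lt[OF f] by (intro sum_strict_mono_ex1) auto
  moreover have "(\<Sum>e\<in>UNIV. (1/2) * w e (x $ e) + (1/2) * w e (y $ e)) =
      (1/2) * total_utility w x + (1/2) * total_utility w y"
    by (simp add: total_utility_def sum.distrib sum_distrib_left)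
  moreover have "total_utility w z \<le> total_utility w y"
    unfolding z_def by (intro max feasible_segment x y) auto
  ultimately show ?thesis by simp
qed

section \<open>Optimality of the responses\<close>

lemma weighted_log_eq:
  assumes "\<And>e. 0 < x $ e" "\<And>e. 0 < y $ e"
  shows "weighted_log w x y = ereal (\<Sum>e\<in>UNIV. x $ e * deriv (w e) (x $ e) * ln (y $ e))"
  using assms by (simp add: weighted_log_def payment_def log_ext_def less_imp_neq[symmetric])

text \<open>All payments are positive, so the zero coordinate contributes
  \<open>-\<infinity>\<close>, and no other term is \<open>\<infinity>\<close> to offset it.\<close>

lemma weighted_log_eq_MInfty:
  assumes w: "\<And>e. utility_fun (w e)" and x: "\<And>e. 0 < x $ e" and y: "y $ f = 0"
  shows "weighted_log w x y = -\<infinity>"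
proof -
  let ?t = "\<lambda>e. ereal (payment (w e) (x $ e)) * log_ext (y $ e)"
  have p: "0 < payment (w e) (x $ e)" for e
    using x utility_fun_deriv_pos[OF w x] by (simp add: payment_def)
  have "?t e \<noteq> \<infinity>" for e using p[of e] by (auto simp: log_ext_def)
  then have "(\<Sum>e\<in>UNIV - {f}. ?t e) \<noteq> \<infinity>" by (simp add: sum_Pinfty)
  moreover have "?t f = -\<infinity>"
    using p[of f] y by (subst y) (simp add: log_ext_def)
  moreover have "weighted_log w x y = ?t f + (\<Sum>e\<in>UNIV - {f}. ?t e)"
    unfolding weighted_log_def by (simp add: sum.remove)
  ultimately show ?thesis by (simp only: ereal_plus_eq_MInfty) simp
qed

text \<open>An interior point gives the objective a finite value, so a maximizer has no zero
  coordinate. The objective is then differentiable at \<open>v\<close>, and its derivative towards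
  \<open>u\<close> is nonpositive.\<close>

lemma response_optimality:
  assumes w: "\<And>e. utility_fun (w e)" and x: "\<And>e. 0 < x $ e"
    and int: "has_interior_feasible_point A c"
    and v: "v \<in> response_set A c w x"
  shows "v \<in> feasible A c" and "0 < v $ e"
    and "u \<in> feasible A c \<Longrightarrow>
      (\<Sum>e\<in>UNIV. x $ e * deriv (w e) (x $ e) * (u $ e / v $ e)) \<le> (\<Sum>e\<in>UNIV. x $ e * deriv (w e) (x $ e))"
proof -
  show vf: "v \<in> feasible A c" using v by (simp add: response_set_def is_arg_max_def)
  have max: "weighted_log w x u \<le> weighted_log w x v" if "u \<in> feasible A c" for u
    using v that by (auto simp: response_set_def is_arg_max_def not_less)
  obtain i where i: "\<And>e. 0 < i $ e" "i \<in> feasible A c"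
    using int unfolding has_interior_feasible_point_def feasible_def
    by (auto intro: less_imp_le)
  have vpos: "0 < v $ e" for e
  proof (rule ccontr)
    assume "\<not> 0 < v $ e"
    then have "v $ e = 0" using vf by (auto simp: feasible_def intro: antisym)
    then have "weighted_log w x v = -\<infinity>" by (rule weighted_log_eq_MInfty[OF w x])
    then show False using max[OF i(2)] weighted_log_eq[OF x i(1)] by simp
  qed
  then show "0 < v $ e" .
  assume u: "u \<in> feasible A c"
  let ?p = "\<lambda>e. x $ e * deriv (w e) (x $ e)"
  define \<phi> where "\<phi> = (\<lambda>t. \<Sum>e\<in>UNIV. ?p e * ln (v $ e + t * (u $ e - v $ e)))"
  have "\<phi> t \<le> \<phi> 0" if t: "0 < t" "t < 1" for t
  proof -
    \<comment> \<open>For \<open>t < 1\<close> the share of \<open>v\<close> keeps the point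
      positive even where \<open>u\<close> vanishes, so the extended objective is a real
      sum.\<close>
    have "0 < (v + t *\<^sub>R (u - v)) $ e" for e
    proof -
      have "(v + t *\<^sub>R (u - v)) $ e = (1 - t) * v $ e + t * u $ e" by (simp add: algebra_simps)
      also have "\<dots> > 0" using t u vpos[of e] by (intro add_pos_nonneg) (auto simp: feasible_def)
      finally show ?thesis .
    qed
    then show ?thesis
      using max[OF feasible_segment[OF vf u, of t]] t vpos by (simp add: weighted_log_eq x \<phi>_def)
  qed
  moreover have "(\<phi> has_real_derivative (\<Sum>e\<in>UNIV. ?p e * ((u $ e - v $ e) / v $ e))) (at 0)"
    unfolding \<phi>_def using vpos by (auto intro!: DERIV_sum derivative_eq_intros)
  ultimately have "(\<Sum>e\<in>UNIV. ?p e * ((u $ e - v $ e) / v $ e)) \<le> 0"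
    by (intro has_real_derivative_nonpos_if_right_max)
  also have "(\<Sum>e\<in>UNIV. ?p e * ((u $ e - v $ e) / v $ e)) = (\<Sum>e\<in>UNIV. ?p e * (u $ e / v $ e) - ?p e)"
    using vpos by (intro sum.cong) (auto simp: diff_divide_distrib algebra_simps less_imp_neq[symmetric])
  finally show "(\<Sum>e\<in>UNIV. ?p e * (u $ e / v $ e)) \<le> (\<Sum>e\<in>UNIV. ?p e)"
    by (simp add: sum_subtractf)
qed

section \<open>Ascent of the potential\<close>

text \<open>Apply \<open>ln s \<le> s - 1\<close> at \<open>s = x / z\<close> for the new point
  \<open>z\<close>, then compare \<open>1 - x / z\<close> with \<open>a * (1 - x / v)\<close>
  exactly. The ratio \<open>x / v\<close> is the one that the response inequality contains and that
  stays bounded.\<close>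

lemma ln_relaxation_ge:
  assumes "0 < x" "0 < v" "0 \<le> a" "a \<le> (1::real)"
  shows "a * (1 - x / v) \<le> ln (x + a * (v - x)) - ln x"
proof -
  let ?z = "x + a * (v - x)"
  have z: "0 < ?z"
  proof (cases "a = 1")
    case False
    have "0 < (1 - a) * x + a * v" using assms False by (intro add_pos_nonneg) auto
    then show ?thesis by (simp add: algebra_simps)
  qed (use assms in simp)
  have "(1 - x / ?z) - a * (1 - x / v) = a * (1 - a) * (v - x)\<^sup>2 / (v * ?z)"
    using assms z by (simp add: divide_simps power2_eq_square) (simp add: algebra_simps)
  also have "\<dots> \<ge> 0" using assms z by (intro divide_nonneg_nonneg mult_nonneg_nonneg) auto
  finally have "a * (1 - x / v) \<le> 1 - x / ?z" by simp
  also have "\<dots> \<le> ln ?z - ln x"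
    using ln_le_minus_one[of "x / ?z"] assms z by (simp add: ln_div)
  finally show ?thesis .
qed

text \<open>Late enough, every step from below \<open>B - \<kappa>\<close> gains at least
  \<open>a k * (\<eta> / 2)\<close>, so the level is exceeded at some time. From above the level a
  single step loses at most \<open>\<kappa>\<close>, so \<open>V\<close> never falls under
  \<open>B - 2 * \<kappa>\<close> again.\<close>

lemma tendsto_of_approximate_ascent:
  fixes V a d \<epsilon> :: "nat \<Rightarrow> real"
  assumes bound: "\<And>k. V k \<le> B"
    and step: "\<And>k. V k + a k * (d k - \<epsilon> k) \<le> V (Suc k)"
    and a: "\<And>k. 0 \<le> a k" "\<And>k. a k \<le> 1" "\<not> summable a"
    and d: "\<And>k. 0 \<le> d k"
    and \<epsilon>: "\<epsilon> \<longlonglongrightarrow> 0"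
    and gap: "\<And>\<kappa>. 0 < \<kappa> \<Longrightarrow> \<exists>\<eta>>0. \<forall>k. V k \<le> B - \<kappa> \<longrightarrow> \<eta> \<le> d k"
  shows "V \<longlonglongrightarrow> B"
proof -
  have "eventually (\<lambda>k. B - 2 * \<kappa> \<le> V k) sequentially" if \<kappa>: "0 < \<kappa>" for \<kappa>
  proof -
    obtain \<eta> where \<eta>: "0 < \<eta>" "\<And>k. V k \<le> B - \<kappa> \<Longrightarrow> \<eta> \<le> d k" using gap[OF \<kappa>] by auto
    have "eventually (\<lambda>k. \<epsilon> k < min (\<eta> / 2) \<kappa>) sequentially"
      using \<eta> \<kappa> by (intro order_tendstoD(2)[OF \<epsilon>]) simp
    then obtain K where K: "\<And>k. k \<ge> K \<Longrightarrow> \<epsilon> k < \<eta> / 2 \<and> \<epsilon> k < \<kappa>"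
      by (auto simp: eventually_sequentially)
    have low: "V k + a k * (\<eta> / 2) \<le> V (Suc k)" if "k \<ge> K" "V k \<le> B - \<kappa>" for k
    proof -
      have "a k * (\<eta> / 2) \<le> a k * (d k - \<epsilon> k)"
        using K[OF that(1)] \<eta>(2)[OF that(2)] a by (intro mult_left_mono) auto
      then show ?thesis using step[of k] by simp
    qed
    have "\<exists>k\<ge>K. B - \<kappa> < V k"
    proof (rule ccontr)
      assume "\<not> (\<exists>k\<ge>K. B - \<kappa> < V k)"
      then have inc: "a (i + K) * (\<eta> / 2) \<le> V (Suc (i + K)) - V (i + K)" for i
        using low[of "i + K"] by (auto simp: not_less)
      \<comment> \<open>The gains telescope, so staying below the level would bound the partial sums
        of \<open>a\<close>.\<close>
      have "(\<Sum>i<n. a (i + K)) \<le> (B - V K) / (\<eta> / 2)" for n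
      proof -
        have "(\<Sum>i<n. a (i + K)) * (\<eta> / 2) \<le> (\<Sum>i<n. V (Suc i + K) - V (i + K))"
          unfolding sum_distrib_right using inc by (intro sum_mono) simp
        also have "\<dots> = V (n + K) - V K" using sum_lessThan_telescope[of "\<lambda>i. V (i + K)" n] by simp
        also have "\<dots> \<le> B - V K" using bound by simp
        finally show ?thesis using \<eta> by (simp add: field_simps)
      qed
      then have "summable (\<lambda>i. a (i + K))"
        using a by (intro summableI_nonneg_bounded) auto
      then show False using a(3) by (simp add: summable_iff_shift)
    qed
    then obtain k where k: "k \<ge> K" "B - \<kappa> < V k" by auto
    have "B - 2 * \<kappa> \<le> V j" if "j \<ge> k" for j
      using that
    proof (induction rule: dec_induct)
      case base
      then show ?case using k \<kappa> by simp
    next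
      case (step j)
      show ?case
      proof (cases "V j \<le> B - \<kappa>")
        case True
        then show ?thesis using low[of j] step k \<eta> a(1)[of j] mult_nonneg_nonneg[of "a j" "\<eta> / 2"] by linarith
      next
        case False
        have "a j * (d j - \<epsilon> j) \<ge> - \<kappa>"
        proof (cases "d j - \<epsilon> j \<ge> 0")
          case True
          then show ?thesis using a(1)[of j] \<kappa> mult_nonneg_nonneg[of "a j" "d j - \<epsilon> j"] by linarith
        next
          case neg: False
          \<comment> \<open>A factor \<open>a j \<le> 1\<close> only shrinks a loss.\<close>
          then have le: "1 * (d j - \<epsilon> j) \<le> a j * (d j - \<epsilon> j)"
            using a(2)[of j] by (intro mult_right_mono_neg) auto
          have "\<epsilon> j < \<kappa>" using K[of j] step k by auto
          then have "- \<kappa> \<le> 1 * (d j - \<epsilon> j)" using d[of j] by simp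
          then show ?thesis using le by (rule order_trans)
        qed
        then show ?thesis using assms(2)[of j] False by linarith
      qed
    qed
    then show ?thesis by (auto simp: eventually_sequentially)
  qed note * = this
  show ?thesis
  proof (rule order_tendstoI)
    fix u assume "u < B"
    then show "eventually (\<lambda>k. u < V k) sequentially"
      by (intro eventually_mono[OF *[of "(B - u) / 4"]]) (auto simp: field_simps)
  next
    fix u assume "B < u"
    then show "eventually (\<lambda>k. V k < u) sequentially"
      by (intro always_eventually allI le_less_trans[OF bound])
  qed
qed

section \<open>The potential: maximality at the optimum and growth along a step\<close>

definition potential :: "('n::finite \<Rightarrow> real \<Rightarrow> real) \<Rightarrow> real^'n \<Rightarrow> real^'n \<Rightarrow> real" where
  "potential w y x = (\<Sum>e\<in>UNIV. y $ e * log_potential (w e) (y $ e) (ln (x $ e)))"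

text \<open>Coordinates with \<open>y $ e = 0\<close>, where the logarithm is singular, carry weight
  0.\<close>

lemma isCont_potential:
  assumes w: "\<And>e. utility_fun (w e)" and y: "\<And>e. 0 \<le> y $ e"
  shows "isCont (potential w y) y"
  unfolding potential_def
proof (rule continuous_sum)
  fix e
  show "isCont (\<lambda>x. y $ e * log_potential (w e) (y $ e) (ln (x $ e))) y"
  proof (cases "y $ e = 0")
    case False
    then have "isCont (\<lambda>x. ln (x $ e)) y"
      using y[of e] by (intro isCont_ln' continuous_component continuous_ident) auto
    moreover have "isCont (log_potential (w e) (y $ e)) (ln (y $ e))"
      using log_potential_has_derivative[OF w] by (rule DERIV_isCont)
    ultimately have "isCont (\<lambda>x. log_potential (w e) (y $ e) (ln (x $ e))) y"
      by (rule isCont_o2)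
    then show ?thesis by (intro continuous_intros)
  qed simp
qed

text \<open>The tangent of the log potential at \<open>ln (y $ e)\<close> reduces the claim to an
  inequality in \<open>q = x $ e / y $ e\<close>; the linear terms sum to at most 0 by first-order
  optimality. The squares make the bound quantitative: besides maximality at \<open>y\<close> it
  gives convergence on the support.\<close>

lemma potential_gap_ge:
  fixes A :: "real^'n^'m"
  assumes A: "routing_matrix A" and w: "\<And>e. utility_fun (w e)"
    and opt: "is_arg_max (total_utility w) (\<lambda>x. x \<in> feasible A c) y"
    and x: "x \<in> feasible A c" "\<And>e. 0 < x $ e"
  shows "(\<Sum>e\<in>UNIV. y $ e * (deriv (w e) (y $ e) * (sqrt (x $ e / y $ e) - 1)\<^sup>2))
      \<le> potential w y y - potential w y x"
proof -
  let ?g = "\<lambda>e. deriv (w e) (y $ e)"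
  let ?q = "\<lambda>e. x $ e / y $ e"
  have y: "0 \<le> y $ e" for e
    using opt by (auto simp: is_arg_max_def feasible_def)
  have "y $ e * (?g e * (sqrt (?q e) - 1)\<^sup>2) \<le>
      y $ e * log_potential (w e) (y $ e) (ln (y $ e)) - y $ e * log_potential (w e) (y $ e) (ln (x $ e))
      + y $ e * (?g e * (?q e - 1))" for e
  proof (cases "y $ e = 0")
    case False
    then have ye: "0 < y $ e" using y[of e] by simp
    then have q: "0 < ?q e" using x by simp
    \<comment> \<open>Bounding the logarithm of the square root leaves exactly the square
      \<open>(sqrt q - 1)^2\<close>.\<close>
    have "ln (?q e) = 2 * ln (sqrt (?q e))" using q by (simp add: ln_sqrt)
    also have "\<dots> \<le> 2 * (sqrt (?q e) - 1)" using ln_le_minus_one[of "sqrt (?q e)"] q by simp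
    finally have "(sqrt (?q e) - 1)\<^sup>2 \<le> ?q e - 1 - ln (?q e)"
      using q by (simp add: power2_diff)
    then have "?g e * (sqrt (?q e) - 1)\<^sup>2 \<le> ?g e * (?q e - 1 - ln (?q e))"
      using utility_fun_deriv_pos[OF w ye, of e] by (intro mult_left_mono) auto
    also have "\<dots> = ?g e * (ln (y $ e) - ln (x $ e)) + ?g e * (?q e - 1)"
      using ye x(2)[of e] by (simp add: ln_div algebra_simps)
    also have "\<dots> \<le> log_potential (w e) (y $ e) (ln (y $ e)) - log_potential (w e) (y $ e) (ln (x $ e))
        + ?g e * (?q e - 1)"
      using log_potential_diff_ge[OF w x(2) ye, of e "y $ e" e] capped_slope_at[OF w ye, of e] by simp
    finally show ?thesis using ye by (simp flip: distrib_left right_diff_distrib)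
  qed simp
  from sum_mono[OF this]
  have "(\<Sum>e\<in>UNIV. y $ e * (?g e * (sqrt (?q e) - 1)\<^sup>2)) \<le>
      potential w y y - potential w y x + (\<Sum>e\<in>UNIV. y $ e * (?g e * (?q e - 1)))"
    unfolding potential_def by (simp only: sum.distrib sum_subtractf)
  then show ?thesis using optimum_first_order[OF A w opt x(1)] by linarith
qed

text \<open>Concavity in the logarithmic variables bounds the gain with slopes at the new point
  \<open>z\<close>; exchanging them for slopes at \<open>x\<close> costs their difference times
  \<open>1 + R\<close>. Then \<open>capped_slope_gain\<close> produces the utility gap, and the
  payment terms are absorbed by the response inequality tested at \<open>y\<close>.\<close>

lemma potential_step_ge:
  assumes w: "\<And>e. utility_fun (w e)" and y: "\<And>e. 0 \<le> y $ e"
    and x: "\<And>e. 0 < x $ e" and v: "\<And>e. 0 < v $ e" and a: "0 \<le> a" "a \<le> 1"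
    and z: "z = x + a *\<^sub>R (v - x)" "\<And>e. 0 < z $ e"
    and opt: "(\<Sum>e\<in>UNIV. x $ e * deriv (w e) (x $ e) * (y $ e / v $ e)) \<le> (\<Sum>e\<in>UNIV. x $ e * deriv (w e) (x $ e))"
    and R: "\<And>e. x $ e / v $ e \<le> R"
  shows "potential w y x + a * (total_utility w y - total_utility w x -
      (\<Sum>e\<in>UNIV. y $ e * ((1 + R) * \<bar>capped_slope (w e) (y $ e) (z $ e) - capped_slope (w e) (y $ e) (x $ e)\<bar>)))
      \<le> potential w y z"
proof -
  let ?g = "\<lambda>e. capped_slope (w e) (y $ e)"
  let ?H = "\<lambda>e. log_potential (w e) (y $ e)"
  let ?p = "\<lambda>e. x $ e * deriv (w e) (x $ e)"
  let ?d = "\<lambda>e. (1 + R) * \<bar>?g e (z $ e) - ?g e (x $ e)\<bar>"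
  have "a * (w e (y $ e) - w e (x $ e) + ?p e - ?p e * (y $ e / v $ e) - y $ e * ?d e)
      \<le> y $ e * ?H e (ln (z $ e)) - y $ e * ?H e (ln (x $ e))" for e
  proof -
    let ?s = "x $ e / v $ e"
    have s: "0 < ?s" "?s \<le> R" using x v R by auto
    have "\<bar>1 - ?s\<bar> \<le> 1 + R" using s by linarith
    then have "\<bar>(?g e (z $ e) - ?g e (x $ e)) * (1 - ?s)\<bar> \<le> ?d e"
      unfolding abs_mult by (subst mult.commute) (intro mult_right_mono, auto)
    \<comment> \<open>The ratio enters with a minus sign, so the uncapped derivative may replace the
      capped slope; this creates the payment term of the response inequality.\<close>
    moreover have "?g e (x $ e) * ?s \<le> deriv (w e) (x $ e) * ?s"
      using s capped_slope_le_deriv by (intro mult_right_mono) auto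
    ultimately have "?g e (x $ e) - deriv (w e) (x $ e) * ?s - ?d e \<le> ?g e (z $ e) * (1 - ?s)"
      by (simp add: algebra_simps)
    then have "a * (?g e (x $ e) - deriv (w e) (x $ e) * ?s - ?d e) \<le> a * (?g e (z $ e) * (1 - ?s))"
      using a by (intro mult_left_mono)
    also have "\<dots> = ?g e (z $ e) * (a * (1 - ?s))" by simp
    also have "\<dots> \<le> ?g e (z $ e) * (ln (z $ e) - ln (x $ e))"
      using ln_relaxation_ge[OF x v a, of e e] capped_slope_nonneg[OF w y z(2), of e e] z(1)
      by (intro mult_left_mono) auto
    also have "\<dots> \<le> ?H e (ln (z $ e)) - ?H e (ln (x $ e))"
      by (intro log_potential_diff_ge w x z)
    finally have "y $ e * (a * (?g e (x $ e) - deriv (w e) (x $ e) * ?s - ?d e))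
        \<le> y $ e * (?H e (ln (z $ e)) - ?H e (ln (x $ e)))"
      using y by (rule mult_left_mono)
    moreover have "a * (w e (y $ e) - w e (x $ e) + ?p e) \<le> a * (y $ e * ?g e (x $ e))"
      using capped_slope_gain[OF w x y, of e e e] a by (intro mult_left_mono) auto
    moreover have "y $ e * (deriv (w e) (x $ e) * ?s) = ?p e * (y $ e / v $ e)" by simp
    ultimately show ?thesis by (simp add: algebra_simps)
  qed
  from sum_mono[OF this]
  have "a * (total_utility w y - total_utility w x + (\<Sum>e\<in>UNIV. ?p e)
      - (\<Sum>e\<in>UNIV. ?p e * (y $ e / v $ e)) - (\<Sum>e\<in>UNIV. y $ e * ?d e))
      \<le> potential w y z - potential w y x"
    unfolding potential_def total_utility_def
    by (simp only: sum_distrib_left[symmetric] sum.distrib sum_subtractf)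
  moreover have "a * (total_utility w y - total_utility w x - (\<Sum>e\<in>UNIV. y $ e * ?d e))
      \<le> a * (total_utility w y - total_utility w x + (\<Sum>e\<in>UNIV. ?p e)
      - (\<Sum>e\<in>UNIV. ?p e * (y $ e / v $ e)) - (\<Sum>e\<in>UNIV. y $ e * ?d e))"
    using a opt by (intro mult_left_mono) auto
  ultimately show ?thesis by simp
qed

text \<open>Testing the response against a fixed positive feasible point \<open>i\<close> bounds
  each payment times \<open>i $ e / v $ e\<close> by the total payment, which is at most
  \<open>P\<close>. Each payment is at least \<open>x $ e * deriv (w e) M\<close>, since derivatives
  are antitone.\<close>

lemma response_ratio_bounded:
  fixes A :: "real^'n^'m"
  assumes A: "routing_matrix A" and w: "\<And>e. utility_fun (w e)"
    and int: "has_interior_feasible_point A c"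
  shows "\<exists>R. \<forall>x\<in>feasible A c. \<forall>v\<in>response_set A c w x. (\<forall>e. 0 < x $ e) \<longrightarrow> (\<forall>e. x $ e / v $ e \<le> R)"
proof -
  obtain i where i: "\<And>e. 0 < i $ e" "i \<in> feasible A c"
    using int unfolding has_interior_feasible_point_def feasible_def
    by (auto intro: less_imp_le)
  \<comment> \<open>The added 1 makes \<open>M\<close> positive and strictly larger than every
    feasible coordinate.\<close>
  define M where "M = (\<Sum>l\<in>UNIV. \<bar>c $ l\<bar>) + 1"
  define P where "P = (\<Sum>e\<in>UNIV. w e M - w e 0)"
  define r where "r = (\<lambda>e. P / (deriv (w e) M * i $ e))"
  have M: "0 < M" unfolding M_def by (intro add_nonneg_pos sum_nonneg) auto
  have P: "0 \<le> P" unfolding P_def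
    using utility_fun_strict_mono[OF w order_refl M] by (intro sum_nonneg) (simp add: less_imp_le)
  have r: "0 \<le> r e" for e
    using P i(1)[of e] utility_fun_deriv_pos[OF w M, of e] by (simp add: r_def)
  have "x $ e / v $ e \<le> (\<Sum>e\<in>UNIV. r e)"
    if x: "x \<in> feasible A c" "\<And>e. 0 < x $ e" and v: "v \<in> response_set A c w x" for x v e
  proof -
    let ?p = "\<lambda>e. x $ e * deriv (w e) (x $ e)"
    have p: "0 < ?p e" for e using utility_fun_deriv_pos[OF w x(2)] x(2) by simp
    note opt = response_optimality[OF w x(2) int v]
    have xM: "x $ e < M" for e
      using feasible_le_capacity_sum[OF A x(1), of e] by (simp add: M_def)
    have "?p e * (i $ e / v $ e) \<le> (\<Sum>e\<in>UNIV. ?p e * (i $ e / v $ e))"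
      using p i(1) opt(2) by (intro member_le_sum) (auto simp: less_imp_le)
    also have "\<dots> \<le> (\<Sum>e\<in>UNIV. ?p e)" by (rule opt(3)[OF i(2)])
    also have "\<dots> \<le> P" unfolding P_def
    proof (rule sum_mono)
      fix e
      show "?p e \<le> w e M - w e 0"
        using utility_fun_payment_le[OF w x(2), of e e] utility_fun_strict_mono[OF w _ xM, of e e] x(2)[of e]
        by simp
    qed
    finally have *: "(x $ e / v $ e) * (deriv (w e) (x $ e) * i $ e) \<le> P" by (simp add: mult_ac)
    have "(x $ e / v $ e) * (deriv (w e) M * i $ e) \<le> (x $ e / v $ e) * (deriv (w e) (x $ e) * i $ e)"
      using x(2) opt(2) i(1) xM utility_fun_deriv_antimono[OF w x(2), of e M e]
      by (intro mult_left_mono mult_right_mono) (auto simp: less_imp_le)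
    then have "x $ e / v $ e \<le> r e"
      using * i(1)[of e] utility_fun_deriv_pos[OF w M, of e] unfolding r_def
      by (subst pos_le_divide_eq) auto
    also have "\<dots> \<le> (\<Sum>e\<in>UNIV. r e)" using r by (intro member_le_sum) auto
    finally show ?thesis .
  qed
  then show ?thesis by blast
qed

text \<open>Continuity of the potential at \<open>y\<close> keeps points with a potential gap
  outside a ball around \<open>y\<close>. On the compact rest of the feasible set the utility
  attains a maximum, which is below the optimum by uniqueness.\<close>

lemma potential_gap_imp_utility_gap:
  fixes A :: "real^'n^'m"
  assumes A: "routing_matrix A" and w: "\<And>e. utility_fun (w e)"
    and opt: "is_arg_max (total_utility w) (\<lambda>x. x \<in> feasible A c) y"
    and "0 < \<kappa>"
  shows "\<exists>\<eta>>0. \<forall>x\<in>feasible A c. potential w y x \<le> potential w y y - \<kappa> \<longrightarrow>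
    \<eta> \<le> total_utility w y - total_utility w x"
proof -
  have y: "0 \<le> y $ e" for e
    using opt by (auto simp: is_arg_max_def feasible_def)
  have "eventually (\<lambda>x. potential w y y - \<kappa> < potential w y x) (nhds y)"
    using isCont_potential[OF w y] \<open>0 < \<kappa>\<close>
    by (intro order_tendstoD(1)[of _ "potential w y y"]) (auto simp: isCont_def tendsto_nhds_iff)
  then obtain \<delta> where \<delta>: "0 < \<delta>" "\<And>x. dist x y < \<delta> \<Longrightarrow> potential w y y - \<kappa> < potential w y x"
    by (auto simp: eventually_nhds_metric)
  let ?K = "feasible A c - ball y \<delta>"
  have K: "x \<in> ?K" if "x \<in> feasible A c" "potential w y x \<le> potential w y y - \<kappa>" for x
    using that \<delta>(2)[of x] by (cases "dist x y < \<delta>") (auto simp: dist_commute)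
  show ?thesis
  proof (cases "?K = {}")
    case True
    then show ?thesis using K by (intro exI[of _ 1]) auto
  next
    case False
    have "compact ?K" by (intro compact_diff compact_feasible A open_ball)
    moreover have "continuous_on ?K (total_utility w)"
      by (rule continuous_on_subset[OF continuous_on_total_utility[OF w]]) auto
    ultimately obtain m where m: "m \<in> ?K" "\<And>x. x \<in> ?K \<Longrightarrow> total_utility w x \<le> total_utility w m"
      using continuous_attains_sup[OF _ False] by blast
    have "total_utility w m < total_utility w y"
      using m(1) \<delta>(1) by (intro optimum_unique[OF w opt]) auto
    then show ?thesis
      using K m(2) by (intro exI[of _ "total_utility w y - total_utility w m"]) force
  qed
qed

text \<open>On the support of \<open>y\<close> the squares in \<open>potential_gap_ge\<close> are
  squeezed to 0. Off the support the potential carries no information; there optimality of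
  \<open>y\<close> limits the utility gained, and strict monotonicity forces the coordinates to
  0.\<close>

lemma potential_tendsto_imp_tendsto:
  fixes A :: "real^'n^'m"
  assumes A: "routing_matrix A" and w: "\<And>e. utility_fun (w e)"
    and opt: "is_arg_max (total_utility w) (\<lambda>x. x \<in> feasible A c) y"
    and X: "\<And>k. X k \<in> feasible A c" "\<And>k e. 0 < X k $ e"
    and lim: "(\<lambda>k. potential w y (X k)) \<longlonglongrightarrow> potential w y y"
  shows "X \<longlonglongrightarrow> y"
proof -
  have yf: "y \<in> feasible A c" using opt by (simp add: is_arg_max_def)
  then have y: "0 \<le> y $ e" for e by (simp add: feasible_def)
  have supp: "(\<lambda>k. X k $ e) \<longlonglongrightarrow> y $ e" if "y $ e \<noteq> 0" for e
  proof -
    let ?t = "\<lambda>k e. y $ e * (deriv (w e) (y $ e) * (sqrt (X k $ e / y $ e) - 1)\<^sup>2)"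
    have ye: "0 < y $ e" using that y[of e] by simp
    have t: "0 \<le> ?t k f" for k f
      using y[of f] utility_fun_deriv_pos[OF w, of "y $ f" f] by (cases "y $ f = 0") auto
    have "?t k e \<le> potential w y y - potential w y (X k)" for k
    proof -
      have "?t k e \<le> (\<Sum>f\<in>UNIV. ?t k f)" using t by (intro member_le_sum) auto
      also have "\<dots> \<le> potential w y y - potential w y (X k)"
        by (rule potential_gap_ge[OF A w opt X])
      finally show ?thesis .
    qed
    moreover have "(\<lambda>k. potential w y y - potential w y (X k)) \<longlonglongrightarrow> 0"
      using tendsto_diff[OF tendsto_const lim, of "potential w y y"] by simp
    ultimately have "(\<lambda>k. ?t k e) \<longlonglongrightarrow> 0"
      using t by (intro real_tendsto_sandwich[of "\<lambda>_. 0" "\<lambda>k. ?t k e"]) auto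
    then have "(\<lambda>k. ?t k e / (y $ e * deriv (w e) (y $ e))) \<longlonglongrightarrow> 0"
      by (rule tendsto_divide_zero)
    then have "(\<lambda>k. (sqrt (X k $ e / y $ e) - 1)\<^sup>2) \<longlonglongrightarrow> 0"
      using ye utility_fun_deriv_pos[OF w ye, of e] by simp
    then have "(\<lambda>k. sqrt (X k $ e / y $ e) - 1) \<longlonglongrightarrow> 0"
      by simp
    then have "(\<lambda>k. sqrt (X k $ e / y $ e)) \<longlonglongrightarrow> 1"
      by (simp add: LIM_zero_iff)
    then have "(\<lambda>k. (sqrt (X k $ e / y $ e))\<^sup>2 * y $ e) \<longlonglongrightarrow> 1\<^sup>2 * y $ e"
      by (intro tendsto_intros)
    then show ?thesis using ye X(2) by (simp add: less_imp_le)
  qed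
  \<comment> \<open>Utility lost against \<open>y\<close> on its support.\<close>
  define s where "s = (\<lambda>k. \<Sum>e\<in>UNIV. if y $ e = 0 then 0 else w e (y $ e) - w e (X k $ e))"
  have "s \<longlonglongrightarrow> 0"
    unfolding s_def
  proof (rule tendsto_null_sum)
    fix e
    show "(\<lambda>k. if y $ e = 0 then 0 else w e (y $ e) - w e (X k $ e)) \<longlonglongrightarrow> 0"
    proof (cases "y $ e = 0")
      case False
      then have "(\<lambda>k. w e (X k $ e)) \<longlonglongrightarrow> w e (y $ e)"
        using y[of e] by (intro isCont_tendsto_compose[OF utility_fun_isCont[OF w] supp]) auto
      then show ?thesis
        using False tendsto_diff[OF tendsto_const, of "\<lambda>k. w e (X k $ e)" "w e (y $ e)" _ "w e (y $ e)"]
        by simp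
    qed simp
  qed
  have "(\<lambda>k. X k $ e) \<longlonglongrightarrow> y $ e" if y0: "y $ e = 0" for e
  proof (rule order_tendstoI)
    fix u assume "u < y $ e"
    then show "eventually (\<lambda>k. u < X k $ e) sequentially"
      using X(2) y0 by (auto intro!: always_eventually intro: less_trans)
  next
    fix u assume "y $ e < u"
    then have u: "0 < u" using y0 by simp
    have "eventually (\<lambda>k. s k < w e u - w e 0) sequentially"
      using utility_fun_strict_mono[OF w order_refl u, of e] by (intro order_tendstoD(2)[OF \<open>s \<longlonglongrightarrow> 0\<close>]) simp
    then show "eventually (\<lambda>k. X k $ e < u) sequentially"
    proof eventually_elim
      case (elim k)
      \<comment> \<open>Utility gained off the support: the terms are nonnegative, and by optimality
        of \<open>y\<close> their sum is at most \<open>s k\<close>.\<close>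
      let ?h = "\<lambda>f. if y $ f = 0 then w f (X k $ f) - w f 0 else 0"
      have h: "0 \<le> ?h f" for f
        using utility_fun_strict_mono[OF w order_refl X(2), of f k f] by simp
      have "w e (X k $ e) - w e 0 \<le> (\<Sum>f\<in>UNIV. ?h f)"
        using member_le_sum[of e UNIV ?h] h y0 by simp
      also have "\<dots> = (\<Sum>f\<in>UNIV. w f (X k $ f) - w f (y $ f) +
          (if y $ f = 0 then 0 else w f (y $ f) - w f (X k $ f)))"
        by (intro sum.cong) auto
      also have "\<dots> = total_utility w (X k) - total_utility w y + s k"
        by (simp add: total_utility_def s_def sum.distrib sum_subtractf)
      also have "\<dots> \<le> s k"
        using opt X(1)[of k] by (auto simp: is_arg_max_def not_less)
      finally have "w e (X k $ e) < w e u" using elim by simp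
      then show ?case
        using utility_fun_strict_mono[OF w, of u "X k $ e" e] u by (cases "X k $ e" u rule: linorder_cases) auto
    qed
  qed
  with supp show ?thesis by (intro vec_tendstoI) blast
qed

section \<open>Assembling the estimates along the iteration\<close>

theorem theorem1:
  fixes A :: "real^'n^'m" and c :: "real^'m"
    and w :: "'n \<Rightarrow> real \<Rightarrow> real"
    and xstar :: "real^'n"
    and X v :: "nat \<Rightarrow> real^'n"
  assumes "routing_matrix A"
    and "\<And>e. utility_fun (w e)"
    and "is_arg_max (total_utility w) (\<lambda>x. x \<in> feasible A c) xstar"
    and "has_interior_feasible_point A c"
    and "X 0 \<in> feasible A c"
    and "\<And>e. 0 < X 0 $ e"
    and "\<And>k. v (Suc k) \<in> response_set A c w (X k)"
    and "\<And>k. X (Suc k) = X k + step_size (Suc k) *\<^sub>R (v (Suc k) - X k)"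
  shows "X \<longlonglongrightarrow> xstar"
proof -
  note A = assms(1) and w = assms(2) and opt = assms(3) and int = assms(4)
    and v = assms(7) and rec = assms(8)
  \<comment> \<open>Thus \<open>a k = 1 / (k + 2)\<close>, which explains the shift by 2 in the
    harmonic facts below. Being below 1, it leaves each iterate a positive share of its predecessor,
    so positivity persists.\<close>
  define a where "a = (\<lambda>k. step_size (Suc k))"
  have a: "0 < a k" "a k < 1" for k by (auto simp: a_def step_size_def)
  have vf: "v (Suc k) \<in> feasible A c" for k
    using v[of k] by (simp add: response_set_def is_arg_max_def)
  have X: "X k \<in> feasible A c \<and> (\<forall>e. 0 < X k $ e)" for k
  proof (induction k)
    case (Suc k)
    have "0 < X (Suc k) $ e" for e
    proof -
      have "X (Suc k) $ e = (1 - a k) * X k $ e + a k * v (Suc k) $ e"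
        by (simp add: rec a_def algebra_simps)
      also have "\<dots> > 0"
        using Suc a[of k] vf[of k] by (intro add_pos_nonneg) (auto simp: feasible_def less_imp_le)
      finally show ?thesis .
    qed
    then show ?case
      using Suc vf[of k] a[of k] feasible_segment[of "X k" A c "v (Suc k)" "a k"] by (simp add: rec a_def)
  qed (use assms in auto)
  then have Xf: "X k \<in> feasible A c" and Xpos: "0 < X k $ e" for k e by auto
  note response = response_optimality[OF w Xpos int v]
  have yf: "xstar \<in> feasible A c" using opt by (simp add: is_arg_max_def)
  then have y: "0 \<le> xstar $ e" for e by (simp add: feasible_def)
  obtain R where R: "X k $ e / v (Suc k) $ e \<le> R" for k e
    using response_ratio_bounded[OF A w int] Xf Xpos v by meson
  define M where "M = (\<Sum>l\<in>UNIV. \<bar>c $ l\<bar>)"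
  have XM: "X k $ e \<in> {0<..M}" and vM: "v (Suc k) $ e \<in> {0..M}" for k e
    using Xpos feasible_le_capacity_sum[OF A Xf] feasible_le_capacity_sum[OF A vf] vf
    by (auto simp: M_def feasible_def)
  have a_lim: "a \<longlonglongrightarrow> 0"
    using LIMSEQ_ignore_initial_segment[OF lim_inverse_n, of 2]
    by (simp add: a_def step_size_def inverse_eq_divide add_ac)
  have X_diff: "(\<lambda>k. X (Suc k) $ e - X k $ e) \<longlonglongrightarrow> 0" for e
  proof (rule Lim_null_comparison)
    show "eventually (\<lambda>k. norm (X (Suc k) $ e - X k $ e) \<le> a k * M) sequentially"
    proof (intro always_eventually allI)
      fix k
      have "\<bar>v (Suc k) $ e - X k $ e\<bar> \<le> M" using XM[of k e] vM[of k e] by auto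
      then show "norm (X (Suc k) $ e - X k $ e) \<le> a k * M"
        using a(1)[of k] by (simp add: rec a_def abs_mult)
    qed
    show "(\<lambda>k. a k * M) \<longlonglongrightarrow> 0" using tendsto_mult_left_zero[OF a_lim] .
  qed
  \<comment> \<open>The discretization error of \<open>potential_step_ge\<close>; it vanishes
    because consecutive iterates approach each other and the capped slopes are uniformly
    continuous.\<close>
  define \<epsilon> where "\<epsilon> = (\<lambda>k. \<Sum>e\<in>UNIV. xstar $ e * ((1 + R) *
      \<bar>capped_slope (w e) (xstar $ e) (X (Suc k) $ e) - capped_slope (w e) (xstar $ e) (X k $ e)\<bar>))"
  have "(\<lambda>k. potential w xstar (X k)) \<longlonglongrightarrow> potential w xstar xstar"
  proof (rule tendsto_of_approximate_ascent)
    show "potential w xstar (X k) \<le> potential w xstar xstar" for k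
    proof -
      have "0 \<le> (\<Sum>e\<in>UNIV. xstar $ e * (deriv (w e) (xstar $ e) * (sqrt (X k $ e / xstar $ e) - 1)\<^sup>2))"
      proof (rule sum_nonneg)
        fix e
        show "0 \<le> xstar $ e * (deriv (w e) (xstar $ e) * (sqrt (X k $ e / xstar $ e) - 1)\<^sup>2)"
          using y[of e] utility_fun_deriv_pos[OF w, of "xstar $ e" e] by (cases "xstar $ e = 0") auto
      qed
      then show ?thesis using potential_gap_ge[OF A w opt Xf Xpos, of k] by simp
    qed
    show "potential w xstar (X k) + a k * (total_utility w xstar - total_utility w (X k) - \<epsilon> k)
        \<le> potential w xstar (X (Suc k))" for k
      unfolding \<epsilon>_def
    proof (rule potential_step_ge[OF w y Xpos response(2)])
      show "X (Suc k) = X k + a k *\<^sub>R (v (Suc k) - X k)" by (simp add: rec a_def)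
    qed (use a[of k] Xpos response(3)[OF yf] R in \<open>auto simp: less_imp_le\<close>)
    show "0 \<le> a k" "a k \<le> 1" for k using a[of k] by auto
    show "\<not> summable a"
      using not_summable_harmonic[where 'a = real] summable_iff_shift[of "\<lambda>n. inverse (real n)" 2]
      by (simp add: a_def step_size_def inverse_eq_divide add_ac)
    show "0 \<le> total_utility w xstar - total_utility w (X k)" for k
      using opt Xf[of k] by (auto simp: is_arg_max_def not_less)
    show "\<epsilon> \<longlonglongrightarrow> 0"
      unfolding \<epsilon>_def
      by (intro tendsto_null_sum tendsto_mult_right_zero tendsto_rabs_zero
          capped_slope_diff_tendsto_0[OF w XM XM X_diff])
    show "\<exists>\<eta>>0. \<forall>k. potential w xstar (X k) \<le> potential w xstar xstar - \<kappa> \<longrightarrow>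
        \<eta> \<le> total_utility w xstar - total_utility w (X k)" if "0 < \<kappa>" for \<kappa>
      using potential_gap_imp_utility_gap[OF A w opt that] Xf by blast
  qed
  then show ?thesis by (rule potential_tendsto_imp_tendsto[OF A w opt Xf Xpos])
qed

end
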